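(* Let $n\ge 0$ be an integer, let $a>-1$ and $\alpha,\beta\in\mathbb{R}$ be such that $(a+1)n+\alpha>-1$, and let $\lambda\in(0,1)$. Then for any $x\in(\lambda,1/\lambda)$, $$\lambda^{an+\alpha}(1-\lambda^{2})^{\beta}P_{n}^{(an+\alpha,\beta)}(1-2\lambda^{2})=\frac{1}{\pi}\Re\left\{\int_{0}^{\pi}z^{\alpha+1}\frac{(1-\lambda z)^{\beta}}{z-\lambda}\left(z^{a+1}\frac{1-\lambda z}{z-\lambda}\right)^{n}\Big|_{z=xe^{i\varphi}}\,d\varphi\right\}-\frac{\sin(\pi(an+\alpha))}{\pi}\int_{0}^{x}\frac{(1+\lambda t)^{\beta}t^{\alpha}}{t+\lambda}\left(t^{a+1}\frac{1+\lambda t}{t+\lambda}\right)^{n}dt,$$ where $\Re(\cdot)$ denotes the real part of a complex number.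
   Context: The Jacobi polynomial of degree $n$ with real parameters $A,B$ is $$P_n^{(A,B)}(x)=\sum_{\mu=0}^n\binom{n+A}{n-\mu}\binom{n+B}{\mu}\left(\frac{x-1}{2}\right)^{\mu}\left(\frac{x+1}{2}\right)^{n-\mu},$$ with generalized binomial coefficients. Complex powers are defined with respect to the principal branch of the complex logarithm (argument in $(-\pi,\pi]$). *)

theory Defs
  imports "HOL-Analysis.Analysis"
begin

definition jacobi_P :: "nat \<Rightarrow> real \<Rightarrow> real \<Rightarrow> real \<Rightarrow> real" where
  "jacobi_P n A B x =
     (\<Sum>\<mu>=0..n. ((real n + A) gchoose (n - \<mu>)) * ((real n + B) gchoose \<mu>)
        * ((x - 1) / 2) ^ \<mu> * ((x + 1) / 2) ^ (n - \<mu>))"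

end

theory Submission
  imports Defs "HOL-Complex_Analysis.Complex_Analysis"
begin

text \<open>
  Put \<open>N = (a + 1) * n + \<alpha>\<close> and \<open>\<gamma> = \<beta> + n\<close>. Divided by \<open>z\<close>, the integrand \<open>F z\<close> is
  \<open>z powr N * (1 - lam * z) powr \<gamma> / (z - lam) ^ (n + 1)\<close>. Its residue at \<open>lam\<close> is the Taylor coefficient
  of order \<open>n\<close> of \<open>z powr N * (1 - lam * z) powr \<gamma>\<close> at \<open>lam\<close>, and multiplying the two binomial series
  shows that this is the left-hand side of the claim (\<open>taylor_coeff_eq_jacobi_P\<close>). The identity is the residue theorem for the circle of radius
  \<open>x\<close> slit along the negative real axis: by reflection, the circle gives the real part of the integral
  over the upper half circle, and the two sides of the slit give the sine times the integral from \<open>0\<close> to \<open>x\<close>.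

  The proof uses only the upper half of this contour. Its diameter contains both the pole and the
  branch cut, and they are dealt with as follows.

  The pole is subtracted: the integrand is the sum of its principal part, consisting of explicit functions
  \<open>z * (z - lam) ^ k / (z - lam) ^ (n + 1)\<close> with real Taylor coefficients, and a regular part. The former are
  integrated by elementary primitives, and only \<open>k = n\<close> contributes
  (\<open>half_circle_integral_principal_term\<close>).

  The cut disappears in the variable \<open>w = ln z\<close>: the half circle becomes a vertical segment from
  \<open>Im w = 0\<close> to \<open>Im w = pi\<close>, and the regular part is holomorphic on a convex half strip which contains
  both edges in its interior (\<open>regular_part_exists\<close>). It thus has a primitive there, and differentiating
  its increment along the segment with respect to the radius gives exactly the density of the slit integral
  (\<open>regular_part_integral\<close>).
\<close>

section \<open>Taylor coefficients at the pole and Jacobi polynomials\<close>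

text \<open>Coefficient of \<open>u ^ k\<close> in \<open>(lam + u) powr N * (1 - lam * (lam + u)) powr \<gamma>\<close>, written as the Cauchy
  product of two binomial series.\<close>
definition taylor_coeff :: "real \<Rightarrow> real \<Rightarrow> real \<Rightarrow> nat \<Rightarrow> real" where
  "taylor_coeff N \<gamma> lam k =
     (\<Sum>j=0..k. ((N gchoose (k - j)) * lam powr (N - real (k - j)))
            * ((\<gamma> gchoose j) * (- lam) ^ j * (1 - lam\<^sup>2) powr (\<gamma> - real j)))"

text \<open>The Jacobi polynomial is this Cauchy product in disguise: at \<open>1 - 2 * lam\<^sup>2\<close> its two arguments
  are \<open>- lam\<^sup>2\<close> and \<open>1 - lam\<^sup>2\<close>, and in the summand with index \<open>j\<close> the powers of \<open>lam\<close> and of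
  \<open>1 - lam\<^sup>2\<close> from the two series are \<open>A + 2 * j\<close> and \<open>B + n - j\<close>.\<close>
lemma taylor_coeff_eq_jacobi_P:
  assumes lam: "0 < lam" "lam < 1"
  shows "taylor_coeff (real n + A) (real n + B) lam n
           = lam powr A * (1 - lam\<^sup>2) powr B * jacobi_P n A B (1 - 2 * lam\<^sup>2)"
proof -
  have pos: "1 - lam\<^sup>2 > 0"
    using lam by (simp add: power_less_one_iff abs_square_less_1)
  have *: "lam powr (real n + A - real (n - j)) * ((- lam) ^ j * (1 - lam\<^sup>2) powr (real n + B - real j))
          = lam powr A * (1 - lam\<^sup>2) powr B * ((- (lam\<^sup>2)) ^ j * (1 - lam\<^sup>2) ^ (n - j))"
    if "j \<le> n" for j
  proof -
    have "lam powr (real n + A - real (n - j)) = lam powr A * lam ^ j"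
      using that lam by (simp add: of_nat_diff powr_add powr_realpow)
    moreover have "(1 - lam\<^sup>2) powr (real n + B - real j) = (1 - lam\<^sup>2) powr B * (1 - lam\<^sup>2) ^ (n - j)"
    proof -
      have "real n + B - real j = B + real (n - j)"
        using that by (simp add: of_nat_diff)
      then show ?thesis
        using pos by (simp only: powr_add powr_realpow)
    qed
    moreover have "lam ^ j * (- lam) ^ j = (- (lam\<^sup>2)) ^ j"
      by (simp add: power_mult_distrib [symmetric] power2_eq_square)
    ultimately show ?thesis
      by (simp add: mult_ac)
  qed
  have arg: "(1 - 2 * lam\<^sup>2 - 1) / 2 = - (lam\<^sup>2)" "(1 - 2 * lam\<^sup>2 + 1) / 2 = 1 - lam\<^sup>2"
    by simp_all
  have regroup: "(b * p) * (c * l * q) = s * t * (b * c * u * v)"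
    if "p * (l * q) = s * t * (u * v)" for b p c l q s t u v :: real
  proof -
    have "(b * p) * (c * l * q) = b * c * (p * (l * q))" by simp
    also have "\<dots> = s * t * (b * c * u * v)" by (simp add: that)
    finally show ?thesis .
  qed
  show ?thesis
    unfolding taylor_coeff_def jacobi_P_def sum_distrib_left arg
    by (intro sum.cong refl regroup *) simp
qed

text \<open>The binomial series after pulling out \<open>b powr e\<close>. Since \<open>b\<close> is positive, this factorisation
  is compatible with the principal branch.\<close>
lemma powr_shifted_has_fps_expansion:
  fixes b s e :: real
  assumes "b > 0"
  shows "(\<lambda>u::complex. (of_real b + of_real s * u) powr of_real e) has_fps_expansion
           Abs_fps (\<lambda>k. of_real ((e gchoose k) * s ^ k * b powr (e - real k)))"
proof -
  let ?q = "of_real (s / b) :: complex"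
  have lin: "(\<lambda>u. ?q * u) has_fps_expansion fps_const ?q * fps_X"
    by (intro fps_expansion_intros)
  have "((\<lambda>v. (1 + v) powr of_real e) \<circ> (\<lambda>u. ?q * u)) has_fps_expansion
          fps_compose (fps_binomial (of_real e)) (fps_const ?q * fps_X)"
    by (rule has_fps_expansion_compose [OF has_fps_expansion_binomial_complex lin]) simp
  then have "(\<lambda>u. of_real (b powr e) * (1 + ?q * u) powr of_real e) has_fps_expansion
      fps_const (of_real (b powr e)) * fps_compose (fps_binomial (of_real e)) (fps_const ?q * fps_X)"
    by (intro has_fps_expansion_cmult_left) (simp add: o_def)
  moreover have "fps_const (of_real (b powr e)) * fps_compose (fps_binomial (of_real e)) (fps_const ?q * fps_X)
       = Abs_fps (\<lambda>k. complex_of_real ((e gchoose k) * s ^ k * b powr (e - real k)))"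
  proof (rule fps_ext)
    fix k
    have "complex_of_real e gchoose k = of_real (e gchoose k)"
      by (simp add: gbinomial_prod_rev of_real_prod)
    then show "fps_nth (fps_const (of_real (b powr e)) * fps_compose (fps_binomial (of_real e)) (fps_const ?q * fps_X)) k
       = fps_nth (Abs_fps (\<lambda>k. complex_of_real ((e gchoose k) * s ^ k * b powr (e - real k)))) k"
      using assms
      by (simp add: powr_diff powr_realpow power_divide)
  qed
  moreover have "eventually (\<lambda>u. of_real (b powr e) * (1 + ?q * u) powr of_real e
                     = (of_real b + of_real s * u) powr of_real e) (nhds 0)"
  proof -
    have "eventually (\<lambda>u. 1 + ?q * u \<noteq> 0) (nhds 0)"
      by (intro tendsto_imp_eventually_ne [where c = 1]) (use assms in \<open>auto intro!: tendsto_eq_intros filterlim_ident\<close>)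
    then show ?thesis
    proof eventually_elim
      case (elim u)
      have "of_real b + of_real s * u = of_real b * (1 + ?q * u)"
        using assms by (simp add: field_simps)
      moreover have "(of_real b * (1 + ?q * u)) powr of_real e
          = of_real (b powr e) * (1 + ?q * u) powr of_real e"
      proof -
        have "(of_real b * v) powr of_real e = of_real (b powr e) * v powr of_real e"
          if "v \<noteq> 0" for v :: complex
          using assms that by (simp add: powr_def Ln_times_of_real Ln_of_real distrib_left exp_add flip: exp_of_real)
        with elim show ?thesis by blast
      qed
      ultimately show ?case by simp
    qed
  qed
  ultimately show ?thesis
    by (auto dest: has_fps_expansion_cong [THEN iffD1, rotated 2])
qed

lemma taylor_coeff_has_fps_expansion:
  assumes lam: "0 < lam" "lam < 1"
  shows "(\<lambda>u. (of_real lam + u) powr of_real N * (1 - of_real lam * (of_real lam + u)) powr of_real \<gamma>)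
           has_fps_expansion Abs_fps (\<lambda>k. complex_of_real (taylor_coeff N \<gamma> lam k))"
proof -
  have pos: "1 - lam\<^sup>2 > 0"
    using lam by (simp add: power_less_one_iff abs_square_less_1)
  let ?P = "Abs_fps (\<lambda>k. complex_of_real ((N gchoose k) * 1 ^ k * lam powr (N - real k)))"
  let ?Q = "Abs_fps (\<lambda>k. complex_of_real ((\<gamma> gchoose k) * (- lam) ^ k * (1 - lam\<^sup>2) powr (\<gamma> - real k)))"
  have "(\<lambda>u. (of_real lam + of_real 1 * u) powr of_real N *
          (of_real (1 - lam\<^sup>2) + of_real (- lam) * u) powr of_real \<gamma>) has_fps_expansion ?Q * ?P"
    by (subst mult.commute [of ?Q])
      (intro has_fps_expansion_mult powr_shifted_has_fps_expansion pos lam)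
  moreover have "?Q * ?P = Abs_fps (\<lambda>k. complex_of_real (taylor_coeff N \<gamma> lam k))"
    by (rule fps_ext) (simp add: fps_mult_nth taylor_coeff_def, simp add: mult_ac)
  ultimately show ?thesis
    by (simp add: algebra_simps power2_eq_square)
qed

text \<open>Dividing the Taylor remainder by \<open>u ^ Suc n\<close> shifts the power series. The function is analytic
  at \<open>0\<close>, provided that its value there is the next Taylor coefficient.\<close>
lemma taylor_remainder_has_fps_expansion:
  fixes f :: "complex \<Rightarrow> complex"
  assumes "f has_fps_expansion F"
  shows "(\<lambda>u. if u = 0 then fps_nth F (Suc n)
              else (f u - (\<Sum>k\<le>n. fps_nth F k * u ^ k)) / u ^ Suc n)
           has_fps_expansion fps_shift (Suc n) F"
proof -
  let ?T = "\<Sum>k\<le>n. fps_const (fps_nth F k) * fps_X ^ k"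
  have T: "fps_nth ?T j = (if j \<le> n then fps_nth F j else 0)" for j
    by (simp add: fps_sum_nth if_distrib [of "\<lambda>x. _ * x"] sum.delta cong: if_cong)
  have fps: "(\<lambda>u. f u - (\<Sum>k\<le>n. fps_nth F k * u ^ k)) has_fps_expansion F - ?T"
    by (intro fps_expansion_intros assms)
  show ?thesis
  proof (cases "F - ?T = 0")
    case True
    then have "F = ?T" by simp
    have "fps_shift (Suc n) F = 0" 
      by (subst \<open>F = ?T\<close>, rule fps_ext) (simp add: T)
    moreover have "fps_nth F (Suc n) = 0"
      by (subst \<open>F = ?T\<close>) (simp add: T)
    moreover have "eventually (\<lambda>u. f u - (\<Sum>k\<le>n. fps_nth F k * u ^ k) = 0) (nhds 0)"
      using fps True has_fps_expansion_0_iff by metis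
    then have "eventually (\<lambda>u. (if u = 0 then 0 else (f u - (\<Sum>k\<le>n. fps_nth F k * u ^ k)) / u ^ Suc n) = 0) (nhds 0)"
      by eventually_elim auto
    ultimately show ?thesis
      by (simp only: has_fps_expansion_0_iff)
  next
    case False
    then have "Suc n \<le> subdegree (F - ?T)"
      by (intro subdegree_geI) (auto simp: T)
    from has_fps_expansion_shift [OF fps this refl]
    have "(\<lambda>u. if u = 0 then fps_nth F (Suc n)
              else (f u - (\<Sum>k\<le>n. fps_nth F k * u ^ k)) / u ^ Suc n)
           has_fps_expansion fps_shift (Suc n) (F - ?T)"
      by (simp only: fps_sub_nth T Suc_n_not_le_n if_False diff_zero)
    also have "fps_shift (Suc n) (F - ?T) = fps_shift (Suc n) F"
      by (rule fps_ext) (simp add: T)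
    finally show ?thesis .
  qed
qed

section \<open>Integrals over the upper half circle\<close>

text \<open>If \<open>\<i> * f\<close> is a derivative, the integral of \<open>f\<close> is \<open>- \<i>\<close> times the increment of the primitive, so
  its real part is the increment of \<open>Im \<Psi>\<close>. In the applications the endpoints correspond to the real
  points \<open>x\<close> and \<open>- x\<close> of the half circle, where imaginary parts are easy to control.\<close>
lemma half_circle_integral:
  fixes f \<Psi> :: "complex \<Rightarrow> complex"
  assumes "\<And>\<phi>. \<phi> \<in> {0..pi} \<Longrightarrow> (\<Psi> has_field_derivative \<i> * f (of_real \<phi>)) (at (of_real \<phi>))"
  shows "(\<lambda>\<phi>. f (of_real \<phi>)) integrable_on {0..pi}"
    and "Re (integral {0..pi} (\<lambda>\<phi>. f (of_real \<phi>))) = Im (\<Psi> (of_real pi)) - Im (\<Psi> 0)"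
proof -
  have "((\<lambda>\<phi>. \<i> * f (of_real \<phi>)) has_integral (\<Psi> (of_real pi) - \<Psi> (of_real 0))) {0..pi}"
    by (rule fundamental_theorem_of_calculus)
      (auto intro!: has_vector_derivative_real_field assms)
  from has_integral_mult_right [OF this, of "- \<i>"]
  have *: "((\<lambda>\<phi>. f (of_real \<phi>)) has_integral (- \<i> * (\<Psi> (of_real pi) - \<Psi> 0))) {0..pi}"
    by (simp flip: mult.assoc)
  show "(\<lambda>\<phi>. f (of_real \<phi>)) integrable_on {0..pi}"
    using * by (rule has_integral_integrable)
  show "Re (integral {0..pi} (\<lambda>\<phi>. f (of_real \<phi>))) = Im (\<Psi> (of_real pi)) - Im (\<Psi> 0)"
    using integral_unique [OF *] by simp
qed

text \<open>For \<open>k < n\<close> a primitive is a power of \<open>z - lam\<close>, which is real at both endpoints \<open>x\<close> and \<open>- x\<close>, so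
  nothing is left. For \<open>k = n\<close> the integrand is \<open>z / (z - lam) = 1 + q / (1 - q)\<close> with \<open>q = lam / z\<close>, and
  the second summand has the primitive \<open>Ln (1 - q)\<close>, whose argument stays in the right half plane
  because \<open>lam < x\<close> and which is again real at the endpoints.\<close>
lemma half_circle_integral_principal_term:
  fixes lam x :: real
  assumes "0 < lam" "lam < x" "k \<le> n"
  defines "z \<equiv> \<lambda>y::complex. exp (of_real (ln x) + \<i> * y)"
  defines "f \<equiv> \<lambda>y. z y * (z y - of_real lam) ^ k / (z y - of_real lam) ^ Suc n"
  shows "(\<lambda>\<phi>. f (of_real \<phi>)) integrable_on {0..pi}"
    and "Re (integral {0..pi} (\<lambda>\<phi>. f (of_real \<phi>))) = (if k = n then pi else 0)"
proof -
  have nz: "norm (z (of_real \<phi>)) = x" for \<phi>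
    using assms(1,2) by (simp add: z_def)
  have ne: "z (of_real \<phi>) - of_real lam \<noteq> 0" for \<phi>
  proof
    assume "z (of_real \<phi>) - of_real lam = 0"
    then have "z (of_real \<phi>) = of_real lam" by simp
    with nz [of \<phi>] assms(1,2) show False by simp
  qed
  have z': "(z has_field_derivative \<i> * z y) (at y)" for y
    unfolding z_def by (auto intro!: derivative_eq_intros)
  have z0: "z y \<noteq> 0" for y by (simp add: z_def)
  have zends: "z 0 = of_real x" "z (of_real pi) = - of_real x"
    using assms(1,2) by (simp_all add: z_def exp_add exp_of_real)
  have "(\<lambda>\<phi>. f (of_real \<phi>)) integrable_on {0..pi} \<and>
        Re (integral {0..pi} (\<lambda>\<phi>. f (of_real \<phi>))) = (if k = n then pi else 0)"
  proof (cases "k = n")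
    case True
    define \<Psi> where "\<Psi> = (\<lambda>y. \<i> * y + Ln (1 - of_real lam / z y))"
    have "(\<Psi> has_field_derivative \<i> * f (of_real \<phi>)) (at (of_real \<phi>))" for \<phi>
    proof -
      have "norm (of_real lam / z (of_real \<phi>)) < 1"
        using assms(1,2) nz [of \<phi>] by (simp add: norm_divide)
      then have "Re (of_real lam / z (of_real \<phi>)) < 1"
        using complex_Re_le_cmod le_less_trans by blast
      then have slit: "1 - of_real lam / z (of_real \<phi>) \<notin> \<real>\<^sub>\<le>\<^sub>0"
        by (auto simp: complex_nonpos_Reals_iff)
      have "((\<lambda>y. 1 - of_real lam / z y) has_field_derivative \<i> * (of_real lam / z (of_real \<phi>))) (at (of_real \<phi>))"
        using z0 [of "of_real \<phi>"] by (auto intro!: derivative_eq_intros z' simp: field_simps)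
      from DERIV_chain2 [OF has_field_derivative_Ln [OF slit] this]
      have "(\<Psi> has_field_derivative \<i> + inverse (1 - of_real lam / z (of_real \<phi>)) *
               (\<i> * (of_real lam / z (of_real \<phi>)))) (at (of_real \<phi>))"
        unfolding \<Psi>_def by (intro DERIV_add DERIV_cmult_Id)
      also have "\<i> + inverse (1 - of_real lam / z (of_real \<phi>)) * (\<i> * (of_real lam / z (of_real \<phi>)))
          = \<i> * f (of_real \<phi>)"
        using ne [of \<phi>] z0 [of "of_real \<phi>"] True by (simp add: f_def divide_simps) (simp add: algebra_simps)
      finally show ?thesis .
    qed
    note * = half_circle_integral [where f = f and \<Psi> = \<Psi>, OF this]
    have "1 - complex_of_real lam / of_real x = of_real (1 - lam / x)"
         "1 + complex_of_real lam / of_real x = of_real (1 + lam / x)"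
      by simp_all
    moreover have "1 - lam / x > 0" "1 + lam / x > 0"
      using assms by (simp_all add: add_pos_pos)
    ultimately have "Im (Ln (1 - complex_of_real lam / of_real x)) = 0"
      "Im (Ln (1 + complex_of_real lam / of_real x)) = 0"
      by (simp_all only: Im_Ln_of_real)
    then have "Im (\<Psi> (of_real pi)) - Im (\<Psi> 0) = pi"
      by (simp add: \<Psi>_def zends)
    with * True show ?thesis by simp
  next
    case False
    define m where "m = n - k"
    have m: "m > 0" using False assms by (simp add: m_def)
    define \<Psi> where "\<Psi> = (\<lambda>y. - inverse ((z y - of_real lam) ^ m) / of_nat m)"
    have "(\<Psi> has_field_derivative \<i> * f (of_real \<phi>)) (at (of_real \<phi>))" for \<phi>
    proof -
      have "f (of_real \<phi>) = z (of_real \<phi>) / (z (of_real \<phi>) - of_real lam) ^ Suc m"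
      proof -
        have "Suc n = k + Suc m" using assms by (simp add: m_def)
        then show ?thesis
          using ne [of \<phi>] by (simp only: f_def power_add) simp
      qed
      moreover obtain l where l: "m = Suc l" using m gr0_implies_Suc by blast
      have "((\<lambda>y. z y - of_real lam) has_field_derivative \<i> * z (of_real \<phi>)) (at (of_real \<phi>))"
        by (auto intro!: derivative_eq_intros z')
      from DERIV_cdivide [OF DERIV_minus [OF DERIV_inverse_fun [OF DERIV_power_Suc [OF this, of l]]], of "of_nat m"]
      have "(\<Psi> has_field_derivative
          - (- ((1 + of_nat l) * (\<i> * z (of_real \<phi>) * (z (of_real \<phi>) - of_real lam) ^ l)
                * inverse (((z (of_real \<phi>) - of_real lam) ^ Suc l) ^ Suc (Suc 0)))) / of_nat m)
          (at (of_real \<phi>))"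
        using ne [of \<phi>] unfolding \<Psi>_def l by simp
      moreover have "- (- ((1 + of_nat l) * (\<i> * v * q ^ l) * inverse ((q ^ Suc l) ^ Suc (Suc 0)))) / of_nat m
          = \<i> * (v / q ^ Suc m)" if "q \<noteq> 0" for q v :: complex
      proof -
        have "(1 + of_nat l :: complex) \<noteq> 0"
          by (metis of_nat_Suc of_nat_neq_0)
        with that show ?thesis unfolding l by (simp add: divide_simps)
      qed
      ultimately show ?thesis
        using ne [of \<phi>] by simp
    qed
    note * = half_circle_integral [where f = f and \<Psi> = \<Psi>, OF this]
    have "\<Psi> 0 = of_real (- inverse ((x - lam) ^ m) / real m)"
         "\<Psi> (of_real pi) = of_real (- inverse ((- x - lam) ^ m) / real m)"
      by (simp_all add: \<Psi>_def zends)
    then have "Im (\<Psi> (of_real pi)) - Im (\<Psi> 0) = 0"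
      by (simp only: Im_complex_of_real)
    with * False show ?thesis by simp
  qed
  then show "(\<lambda>\<phi>. f (of_real \<phi>)) integrable_on {0..pi}"
    "Re (integral {0..pi} (\<lambda>\<phi>. f (of_real \<phi>))) = (if k = n then pi else 0)"
    by auto
qed

section \<open>The integrand in the logarithmic variable\<close>

text \<open>The integrand as a function of \<open>w = ln z\<close>. It is meromorphic across the line \<open>Im w = pi\<close>, which
  corresponds to the branch cut of \<open>z\<close>.\<close>
definition log_kernel :: "real \<Rightarrow> real \<Rightarrow> real \<Rightarrow> nat \<Rightarrow> complex \<Rightarrow> complex" where
  "log_kernel N \<gamma> lam n w =
     exp (of_real (N + 1) * w) * (1 - of_real lam * exp w) powr of_real \<gamma>
       / (exp w - of_real lam) ^ Suc n"

text \<open>With the Taylor coefficients above for \<open>c\<close>, this is \<open>z\<close> times the principal part of the Laurent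
  expansion at \<open>lam\<close> of (integrand divided by \<open>z\<close>), where \<open>z = exp w\<close>. The quotient of powers is kept
  unsimplified so that the sum combines directly with \<open>log_kernel\<close>.\<close>
definition principal_part :: "(nat \<Rightarrow> real) \<Rightarrow> real \<Rightarrow> nat \<Rightarrow> complex \<Rightarrow> complex" where
  "principal_part c lam n w =
     (\<Sum>k\<le>n. of_real (c k) * (exp w * (exp w - of_real lam) ^ k / (exp w - of_real lam) ^ Suc n))"

text \<open>The image under \<open>exp\<close> is the disc of radius \<open>1 / lam\<close> punctured at \<open>0\<close>. The bound \<open>2 * pi\<close> is chosen to
  have the line \<open>Im w = pi\<close> in the interior, but only the real logarithm of \<open>lam\<close> in the strip.\<close>
definition half_strip :: "real \<Rightarrow> complex set" where
  "half_strip lam = {w. Re w < - ln lam \<and> Im w < 2 * pi \<and> - (2 * pi) < Im w}"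

lemma half_strip_Int:
  "half_strip lam = {w. Re w < - ln lam} \<inter> {w. Im w < 2 * pi} \<inter> {w. Im w > - (2 * pi)}"
  by (auto simp: half_strip_def)

lemma open_half_strip: "open (half_strip lam)"
  unfolding half_strip_Int
  by (intro open_Int open_halfspace_Re_lt open_halfspace_Im_lt open_halfspace_Im_gt)

lemma convex_half_strip: "convex (half_strip lam)"
  unfolding half_strip_Int
  by (intro convex_Int convex_halfspace_Re_lt convex_halfspace_Im_lt convex_halfspace_Im_gt)

lemma half_strip_slit:
  assumes "0 < lam" "w \<in> half_strip lam"
  shows "0 < Re (1 - of_real lam * exp w)"
proof -
  have "Re (of_real lam * exp w) \<le> norm (of_real lam * exp w)"
    by (rule complex_Re_le_cmod)
  also have "\<dots> = exp (ln lam + Re w)"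
    using assms by (simp add: norm_mult exp_add)
  also have "\<dots> < exp 0"
    using assms by (intro exp_less_mono) (simp add: half_strip_def)
  finally show ?thesis by simp
qed

lemma half_strip_pole:
  assumes "0 < lam" "w \<in> half_strip lam" "exp w = of_real lam"
  shows "w = of_real (ln lam)"
proof (rule exp_complex_eqI)
  show "exp w = exp (of_real (ln lam))"
    using assms by (simp add: exp_of_real)
  show "\<bar>Im w - Im (of_real (ln lam))\<bar> < 2 * pi"
    using assms(2) by (auto simp: half_strip_def)
qed

lemma log_kernel_holomorphic:
  assumes "0 < lam"
  shows "log_kernel N \<gamma> lam n holomorphic_on (half_strip lam - {of_real (ln lam)})"
  unfolding log_kernel_def
proof (intro holomorphic_intros)
  fix w assume w: "w \<in> half_strip lam - {of_real (ln lam)}"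
  show "1 - of_real lam * exp w \<notin> \<real>\<^sub>\<le>\<^sub>0"
    using half_strip_slit [of lam w] w assms by (simp only: complex_nonpos_Reals_iff) auto
  show "(exp w - of_real lam) ^ Suc n \<noteq> 0"
    using half_strip_pole [of lam w] w assms by auto
qed

text \<open>Near \<open>ln lam\<close> the difference of kernel and principal part is \<open>exp w * R (exp w - lam)\<close>, with \<open>R\<close> the
  analytic Taylor remainder, so the singularity is removable. The value filled in is real, because the
  Taylor coefficients are; hence the regular part has no imaginary part on the whole real axis.\<close>
lemma regular_part_exists:
  assumes lam: "0 < lam" "lam < 1"
  obtains H where "H holomorphic_on half_strip lam"
    and "\<And>w. w \<noteq> of_real (ln lam) \<Longrightarrow>
           H w = log_kernel N \<gamma> lam n w - principal_part (taylor_coeff N \<gamma> lam) lam n w"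
    and "Im (H (of_real (ln lam))) = 0"
proof -
  let ?p = "of_real (ln lam) :: complex"
  let ?c = "taylor_coeff N \<gamma> lam"
  let ?F = "Abs_fps (\<lambda>k. complex_of_real (?c k))"
  define h where "h u = (of_real lam + u) powr of_real N * (1 - of_real lam * (of_real lam + u)) powr of_real \<gamma>"
    for u :: complex
  define R where "R u = (if u = 0 then fps_nth ?F (Suc n)
              else (h u - (\<Sum>k\<le>n. fps_nth ?F k * u ^ k)) / u ^ Suc n)" for u
  define H where "H w = (if w = ?p then of_real (lam * ?c (Suc n))
     else log_kernel N \<gamma> lam n w - principal_part ?c lam n w)" for w
  have "h has_fps_expansion ?F"
    unfolding h_def by (rule taylor_coeff_has_fps_expansion [OF lam])
  then have "R has_fps_expansion fps_shift (Suc n) ?F"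
    unfolding R_def by (rule taylor_remainder_has_fps_expansion)
  then have R: "R analytic_on {0}"
    by (rule has_fps_expansion_imp_analytic_0)
  have p: "?p \<in> half_strip lam" "exp ?p = of_real lam"
    using lam by (simp_all add: half_strip_def exp_of_real)
  have "(\<lambda>w. exp w * (R \<circ> (\<lambda>w. exp w - of_real lam)) w) analytic_on {?p}"
  proof (rule analytic_on_mult)
    show "exp analytic_on {?p}" by (intro analytic_intros)
    have "(\<lambda>w. exp w - of_real lam) analytic_on {?p}" by (intro analytic_intros)
    moreover have "R analytic_on (\<lambda>w. exp w - of_real lam) ` {?p}"
      using R p by simp
    ultimately show "R \<circ> (\<lambda>w. exp w - of_real lam) analytic_on {?p}"
      by (rule analytic_on_compose)
  qed
  moreover have "eventually (\<lambda>w. exp w * (R \<circ> (\<lambda>w. exp w - of_real lam)) w = H w) (nhds ?p)"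
  proof -
    \<comment> \<open>In this narrower strip \<open>Ln\<close> inverts \<open>exp\<close>, so the principal powers of \<open>exp w\<close> are exponentials of \<open>w\<close>.\<close>
    let ?B = "{w. - pi < Im w} \<inter> {w. Im w < pi} \<inter> half_strip lam"
    have "open ?B"
      by (intro open_Int open_half_strip open_Collect_less continuous_intros)
    moreover have "?p \<in> ?B" using p by simp
    ultimately have "eventually (\<lambda>w. w \<in> ?B) (nhds ?p)"
      by (rule eventually_nhds_in_open)
    then show ?thesis
    proof eventually_elim
      case (elim w)
      show ?case
      proof (cases "w = ?p")
        case True
        then show ?thesis using p by (simp add: H_def R_def)
      next
        case False
        then have ne: "exp w - of_real lam \<noteq> 0"
          using half_strip_pole [of lam w] lam elim by auto
        have "Ln (exp w) = w" using elim by simp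
        then have "h (exp w - of_real lam) = exp (of_real N * w) * (1 - of_real lam * exp w) powr of_real \<gamma>"
          by (simp add: h_def powr_def)
        moreover have exp: "exp (of_real (N + 1) * w) = exp w * exp (of_real N * w)"
          by (simp add: distrib_right exp_add)
        ultimately have "exp w * R (exp w - of_real lam) = H w"
          using False ne exp
          by (simp add: R_def H_def log_kernel_def principal_part_def sum_distrib_left sum_divide_distrib
              diff_divide_distrib right_diff_distrib mult_ac)
        then show ?thesis by simp
      qed
    qed
  qed
  ultimately have "H analytic_on {?p}"
    by (rule analytic_at_cong [OF _ refl, THEN iffD1, rotated])
  then obtain U where U: "open U" "?p \<in> U" "H holomorphic_on U"
    using analytic_at by blast
  have "principal_part ?c lam n holomorphic_on (half_strip lam - {?p})"
    unfolding principal_part_def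
    by (intro holomorphic_intros) (use half_strip_pole lam in auto)
  with log_kernel_holomorphic [OF lam(1)]
  have "(\<lambda>w. log_kernel N \<gamma> lam n w - principal_part ?c lam n w) holomorphic_on (half_strip lam - {?p})"
    by (rule holomorphic_on_diff)
  then have "H holomorphic_on (half_strip lam - {?p})"
    by (rule holomorphic_transform) (auto simp: H_def)
  with U have "H holomorphic_on (half_strip lam - {?p} \<union> U)"
    by (intro holomorphic_on_Un open_Diff open_half_strip) auto
  then have "H holomorphic_on half_strip lam"
    by (rule holomorphic_on_subset) (use U in auto)
  then show ?thesis
    by (rule that) (simp_all add: H_def)
qed

section \<open>The integral of the regular part\<close>
definition slit_density :: "real \<Rightarrow> real \<Rightarrow> real \<Rightarrow> nat \<Rightarrow> real \<Rightarrow> real" where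
  "slit_density N \<gamma> lam n t = t powr N * (1 + lam * t) powr \<gamma> / (t + lam) ^ Suc n"

lemma Im_principal_part_eq_0:
  assumes "exp w = of_real r"
  shows "Im (principal_part c lam n w) = 0"
proof -
  have "principal_part c lam n w
          = of_real (\<Sum>k\<le>n. c k * (r * (r - lam) ^ k / (r - lam) ^ Suc n))"
    unfolding principal_part_def assms by simp
  then show ?thesis by (simp only: Im_complex_of_real)
qed

lemma Im_log_kernel_of_real:
  assumes "0 < lam" "s < - ln lam"
  shows "Im (log_kernel N \<gamma> lam n (of_real s)) = 0"
proof -
  have "exp s < exp (- ln lam)" using assms by simp
  then have nonneg: "1 - lam * exp s \<ge> 0"
    using assms by (simp add: exp_minus field_simps)
  have "1 - of_real lam * exp (of_real s) = complex_of_real (1 - lam * exp s)"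
    by (simp add: exp_of_real)
  then have "(1 - of_real lam * exp (of_real s)) powr of_real \<gamma> = complex_of_real ((1 - lam * exp s) powr \<gamma>)"
    by (simp only: powr_of_real [OF nonneg])
  then have "log_kernel N \<gamma> lam n (of_real s)
     = of_real (exp ((N + 1) * s) * (1 - lam * exp s) powr \<gamma> / (exp s - lam) ^ Suc n)"
    by (simp add: log_kernel_def flip: exp_of_real)
  then show ?thesis by (simp only: Im_complex_of_real)
qed

lemma sin_pi_shift: "sin (pi * (N + 1)) = (-1) ^ Suc n * sin (pi * (N - real n))"
proof -
  have "sin (pi * (N + 1)) = sin (pi * (N - real n) + pi * real (Suc n))"
    by (simp add: algebra_simps)
  also have "\<dots> = (-1) ^ Suc n * sin (pi * (N - real n))"
    by (simp only: sin_add cos_npi2 sin_npi2) simp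
  finally show ?thesis .
qed

lemma exp_log_polar:
  assumes "t > 0"
  shows "exp (of_real (ln t) + \<i> * of_real \<phi>) = of_real t * cis \<phi>"
  using assms by (simp add: exp_add exp_of_real cis_conv_exp)

lemma exp_scaled_log_polar:
  assumes "t > 0"
  shows "exp (of_real e * (of_real (ln t) + \<i> * of_real \<phi>)) = of_real (t powr e) * cis (e * \<phi>)"
  using assms
  by (simp add: distrib_left exp_add powr_def cis_conv_exp mult_ac flip: exp_of_real)

text \<open>On the upper side of the cut the power contributes the phase \<open>pi * (N + 1)\<close>, and the sign of
  \<open>(- t - lam) ^ Suc n\<close> turns \<open>sin (pi * (N + 1))\<close> into \<open>sin (pi * (N - n))\<close>.\<close>
lemma Im_log_kernel_upper_edge:
  assumes "0 < lam" "0 < t"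
  shows "Im (log_kernel N \<gamma> lam n (of_real (ln t) + \<i> * of_real pi))
           = t * (sin (pi * (N - real n)) * slit_density N \<gamma> lam n t)"
proof -
  let ?w = "of_real (ln t) + \<i> * of_real pi"
  have e: "exp ?w = of_real (- t)"
    using exp_log_polar [OF assms(2), of pi] by simp
  have "log_kernel N \<gamma> lam n ?w
     = of_real (t powr (N + 1)) * cis ((N + 1) * pi)
         * of_real ((1 + lam * t) powr \<gamma> / (- t - lam) ^ Suc n)"
  proof -
    have "1 - of_real lam * exp ?w = of_real (1 + lam * t)"
      unfolding e by simp
    moreover have "1 + lam * t \<ge> 0" using assms by simp
    ultimately have "(1 - of_real lam * exp ?w) powr of_real \<gamma> = of_real ((1 + lam * t) powr \<gamma>)"
      by (simp only: powr_of_real)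
    moreover have "(exp ?w - of_real lam) ^ Suc n = of_real ((- t - lam) ^ Suc n)"
      unfolding e by simp
    ultimately show ?thesis
      unfolding log_kernel_def exp_scaled_log_polar [OF assms(2)] by simp
  qed
  then have "Im (log_kernel N \<gamma> lam n ?w)
     = t powr (N + 1) * sin (pi * (N + 1)) * ((1 + lam * t) powr \<gamma> / (- t - lam) ^ Suc n)"
    by (simp add: mult_ac)
  also have "- t - lam = (-1) * (t + lam)"
    by simp
  also have "((-1) * (t + lam)) ^ Suc n = (-1) ^ Suc n * (t + lam) ^ Suc n"
    by (rule power_mult_distrib)
  also have "t powr (N + 1) * sin (pi * (N + 1)) * ((1 + lam * t) powr \<gamma> / ((-1) ^ Suc n * (t + lam) ^ Suc n))
     = t * (sin (pi * (N - real n)) * slit_density N \<gamma> lam n t)"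
    unfolding sin_pi_shift [of N n] slit_density_def
    using assms by (simp add: powr_add mult_ac)
  finally show ?thesis .
qed

text \<open>Writing \<open>z = exp w\<close>, the regular part is \<open>z powr (N + 1) * P z - z * Q z\<close> with \<open>P\<close> and \<open>Q\<close> continuous, hence bounded,
  on a disc about \<open>0\<close> which avoids \<open>lam\<close>.\<close>
lemma regular_part_bound_at_0:
  assumes lam: "0 < lam" "lam < 1"
  obtains C where "\<And>w. Re w \<le> ln (lam / 2) \<Longrightarrow>
    norm (log_kernel N \<gamma> lam n w - principal_part c lam n w) \<le> C * (exp ((N + 1) * Re w) + exp (Re w))"
proof -
  let ?B = "cball (0 :: complex) (lam / 2)"
  define P where "P z = (1 - of_real lam * z) powr of_real \<gamma> / (z - of_real lam) ^ Suc n" for z :: complex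
  define Q where "Q z = (\<Sum>k\<le>n. of_real (c k) * ((z - of_real lam) ^ k / (z - of_real lam) ^ Suc n))"
    for z :: complex
  have ne: "(z - of_real lam) ^ Suc n \<noteq> 0" if "z \<in> ?B" for z
    using that lam by auto
  have slit: "0 < Re (1 - of_real lam * z)" if "z \<in> ?B" for z
  proof -
    have "Re (of_real lam * z) \<le> norm (of_real lam * z)"
      by (rule complex_Re_le_cmod)
    also have "\<dots> \<le> lam * 1"
      using that lam by (simp only: norm_mult norm_of_real) (intro mult_mono, auto)
    finally have "Re (of_real lam * z) < 1"
      using lam(2) by (simp only: mult_1_right)
    then show ?thesis by simp
  qed
  have "continuous_on ?B (\<lambda>z. (1 - of_real lam * z) powr of_real \<gamma>)"
  proof (rule continuous_on_powr_complex)
    show "?B \<subseteq> {z. 0 \<le> Re (1 - of_real lam * z) \<or> Im (1 - of_real lam * z) \<noteq> 0}"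
      using slit less_imp_le by blast
    show "0 < Re (of_real \<gamma>)" if "z \<in> ?B" "1 - of_real lam * z = 0" for z :: complex
      using slit [OF that(1)] unfolding that(2) by simp
  qed (intro continuous_intros)+
  then have "continuous_on ?B P"
    unfolding P_def by (rule continuous_on_divide) (use ne in \<open>auto intro!: continuous_intros\<close>)
  moreover have "continuous_on ?B Q"
    unfolding Q_def
    by (intro continuous_on_sum continuous_on_mult continuous_on_const continuous_on_divide
        continuous_on_power continuous_on_diff continuous_on_id) (use ne in blast)
  ultimately have "bounded (P ` ?B)" "bounded (Q ` ?B)"
    by (simp_all add: compact_continuous_image compact_imp_bounded)
  then obtain C1 C2 where C: "\<And>z. z \<in> ?B \<Longrightarrow> norm (P z) \<le> C1" "\<And>z. z \<in> ?B \<Longrightarrow> norm (Q z) \<le> C2"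
    unfolding bounded_iff by blast
  show ?thesis
  proof (rule that [of "max C1 C2"])
    fix w :: complex
    assume w: "Re w \<le> ln (lam / 2)"
    have "exp (Re w) \<le> exp (ln (lam / 2))" using w by (simp only: exp_le_cancel_iff)
    then have B: "exp w \<in> ?B" using lam by simp
    have "log_kernel N \<gamma> lam n w - principal_part c lam n w
        = exp (of_real (N + 1) * w) * P (exp w) - exp w * Q (exp w)"
      unfolding log_kernel_def principal_part_def P_def Q_def
      by (simp add: sum_distrib_left mult_ac)
    also have "norm \<dots> \<le> exp ((N + 1) * Re w) * norm (P (exp w)) + exp (Re w) * norm (Q (exp w))"
      by (rule order_trans [OF norm_triangle_ineq4]) (simp add: norm_mult)
    also have "\<dots> \<le> exp ((N + 1) * Re w) * max C1 C2 + exp (Re w) * max C1 C2"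
      using C [OF B] by (intro add_mono mult_left_mono) auto
    finally show "norm (log_kernel N \<gamma> lam n w - principal_part c lam n w)
        \<le> max C1 C2 * (exp ((N + 1) * Re w) + exp (Re w))"
      by (simp add: algebra_simps)
  qed
qed

text \<open>The function \<open>Re (J r)\<close> of the radius is an increment of the imaginary part of a primitive
  \<open>\<Phi>\<close> between the lines \<open>Im w = 0\<close> and \<open>Im w = pi\<close>. Its derivative therefore only sees the imaginary
  part of the regular part on these lines: zero on the first, the density of the slit integral on the
  second. As \<open>Re (J r)\<close> vanishes for \<open>r \<rightarrow> 0\<close>, where \<open>N > -1\<close> enters, the fundamental theorem of
  calculus gives the claim.\<close>
lemma regular_part_integral:
  assumes lam: "0 < lam" "lam < 1" and N: "N > -1" and x: "0 < x" "x < 1 / lam"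
    and hol: "H holomorphic_on half_strip lam"
    and H: "\<And>w. w \<noteq> of_real (ln lam) \<Longrightarrow> H w = log_kernel N \<gamma> lam n w - principal_part c lam n w"
    and H_pole: "Im (H (of_real (ln lam))) = 0"
  defines "J \<equiv> \<lambda>r. integral {0..pi} (\<lambda>\<phi>. H (of_real (ln r) + \<i> * of_real \<phi>))"
  shows "(\<lambda>\<phi>. H (of_real (ln x) + \<i> * of_real \<phi>)) integrable_on {0..pi}"
    and "((\<lambda>t. sin (pi * (N - real n)) * slit_density N \<gamma> lam n t) has_integral Re (J x)) {0..x}"
proof -
  obtain \<Phi> where "\<And>w. w \<in> half_strip lam \<Longrightarrow> (\<Phi> has_field_derivative H w) (at w within half_strip lam)"
    using holomorphic_convex_primitive [OF convex_half_strip finite.emptyI holomorphic_on_imp_continuous_on [OF hol]]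
      hol open_half_strip holomorphic_on_imp_differentiable_at interior_open
    by (metis Diff_empty)
  then have \<Phi>: "(\<Phi> has_field_derivative H w) (at w)" if "w \<in> half_strip lam" for w
    using that open_half_strip at_within_open by metis
  have ln_less: "ln t < - ln lam" if "0 < t" "t < 1 / lam" for t
    using that lam by (simp add: ln_less_cancel_iff [of t "1 / lam", symmetric] ln_div)
  have strip: "of_real (ln t) + \<i> * of_real \<phi> \<in> half_strip lam"
    if "0 < t" "t < 1 / lam" "\<phi> \<in> {0..pi}" for t \<phi>
    using that ln_less [of t] pi_gt_zero by (auto simp: half_strip_def simp del: pi_gt_zero)
  have int: "(\<lambda>\<phi>. H (of_real (ln t) + \<i> * of_real \<phi>)) integrable_on {0..pi}"
    and J: "Re (J t) = Im (\<Phi> (of_real (ln t) + \<i> * of_real pi)) - Im (\<Phi> (of_real (ln t)))"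
    if t: "0 < t" "t < 1 / lam" for t
  proof -
    have "((\<lambda>y. \<Phi> (of_real (ln t) + \<i> * y)) has_field_derivative
        \<i> * H (of_real (ln t) + \<i> * of_real \<phi>)) (at (of_real \<phi>))" if "\<phi> \<in> {0..pi}" for \<phi>
    proof -
      have "((\<lambda>y. of_real (ln t) + \<i> * y) has_field_derivative \<i>) (at (of_real \<phi>))"
        by (auto intro!: derivative_eq_intros)
      from DERIV_chain2 [OF \<Phi> [OF strip [OF t that]] this] show ?thesis
        by (simp add: mult.commute)
    qed
    from half_circle_integral [where \<Psi> = "\<lambda>y. \<Phi> (of_real (ln t) + \<i> * y)"
        and f = "\<lambda>y. H (of_real (ln t) + \<i> * y)", OF this]
    show "(\<lambda>\<phi>. H (of_real (ln t) + \<i> * of_real \<phi>)) integrable_on {0..pi}"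
      "Re (J t) = Im (\<Phi> (of_real (ln t) + \<i> * of_real pi)) - Im (\<Phi> (of_real (ln t)))"
      by (simp_all add: J_def)
  qed
  show "(\<lambda>\<phi>. H (of_real (ln x) + \<i> * of_real \<phi>)) integrable_on {0..pi}"
    by (rule int [OF x])

  \<comment> \<open>The value at \<open>0\<close> is the limit, so that \<open>K\<close> is continuous on the closed interval.\<close>
  define K where "K t = (if t = 0 then 0 else Re (J t))" for t
  have edge: "((\<lambda>t. Im (\<Phi> (of_real (ln t) + \<i> * of_real \<theta>))) has_real_derivative
                 Im (H (of_real (ln t) + \<i> * of_real \<theta>)) / t) (at t)"
    if t: "0 < t" "t < 1 / lam" and \<theta>: "\<theta> \<in> {0..pi}" for t \<theta>
  proof -
    have "((\<lambda>y. Ln y + \<i> * of_real \<theta>) has_field_derivative inverse (of_real t)) (at (of_real t))"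
      using t by (auto intro!: derivative_eq_intros)
    moreover have "Ln (of_real t) = of_real (ln t)"
      using t by (simp add: Ln_of_real)
    ultimately have "((\<lambda>y. \<Phi> (Ln y + \<i> * of_real \<theta>)) has_field_derivative
        H (of_real (ln t) + \<i> * of_real \<theta>) * inverse (of_real t)) (at (of_real t))"
      using DERIV_chain2 [where f = \<Phi> and g = "\<lambda>y. Ln y + \<i> * of_real \<theta>"] \<Phi> [OF strip [OF t \<theta>]] by metis
    then have "((\<lambda>s. \<Phi> (Ln (of_real s) + \<i> * of_real \<theta>)) has_vector_derivative
        H (of_real (ln t) + \<i> * of_real \<theta>) * inverse (of_real t)) (at t)"
      by (rule has_vector_derivative_real_field)
    then have "((\<lambda>s. Im (\<Phi> (Ln (of_real s) + \<i> * of_real \<theta>))) has_vector_derivative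
        Im (H (of_real (ln t) + \<i> * of_real \<theta>) * inverse (of_real t))) (at t)"
      by (rule bounded_linear.has_vector_derivative [OF bounded_linear_Im])
    moreover have "Im (h * inverse (of_real t)) = Im h / t" for h
      by (simp add: Im_divide_of_real flip: divide_inverse)
    ultimately have "((\<lambda>s. Im (\<Phi> (Ln (of_real s) + \<i> * of_real \<theta>))) has_real_derivative
        Im (H (of_real (ln t) + \<i> * of_real \<theta>)) / t) (at t)"
      by (simp add: has_real_derivative_iff_has_vector_derivative)
    moreover have "eventually (\<lambda>s. Im (\<Phi> (Ln (of_real s) + \<i> * of_real \<theta>))
         = Im (\<Phi> (of_real (ln s) + \<i> * of_real \<theta>))) (nhds t)"
      using eventually_nhds_in_open [of "{0<..}" t] t
      by (auto elim!: eventually_mono simp: Ln_of_real)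
    ultimately show ?thesis
      by (rule DERIV_cong_ev [OF refl _ refl, THEN iffD1, rotated])
  qed
  have Im_H_real: "Im (H (of_real (ln t))) = 0" if "0 < t" "t < 1 / lam" for t
  proof (cases "t = lam")
    case False
    then have "complex_of_real (ln t) \<noteq> of_real (ln lam)" using that lam by simp
    moreover have "exp (of_real (ln t)) = complex_of_real t"
      using that by (simp add: exp_of_real)
    ultimately show ?thesis
      using that lam by (simp add: H Im_principal_part_eq_0 Im_log_kernel_of_real ln_less)
  qed (use H_pole in simp)
  have Im_H_edge: "Im (H (of_real (ln t) + \<i> * of_real pi))
      = t * (sin (pi * (N - real n)) * slit_density N \<gamma> lam n t)" if "0 < t" "t < 1 / lam" for t
  proof -
    let ?w = "of_real (ln t) + \<i> * of_real pi"
    have ne: "?w \<noteq> complex_of_real (ln lam)"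
      by (simp add: complex_eq_iff)
    have e: "exp ?w = complex_of_real (- t)"
      using exp_log_polar [of t pi] that by simp
    have "Im (H ?w) = Im (log_kernel N \<gamma> lam n ?w) - Im (principal_part c lam n ?w)"
      by (simp only: H [OF ne] minus_complex.sel)
    also have "\<dots> = t * (sin (pi * (N - real n)) * slit_density N \<gamma> lam n t)"
      by (simp only: Im_log_kernel_upper_edge [OF lam(1) that(1)] Im_principal_part_eq_0 [OF e] diff_zero)
    finally show ?thesis .
  qed
  have K': "(K has_real_derivative sin (pi * (N - real n)) * slit_density N \<gamma> lam n t) (at t)"
    if t: "0 < t" "t < 1 / lam" for t
  proof -
    have "((\<lambda>t. Im (\<Phi> (of_real (ln t) + \<i> * of_real pi)) - Im (\<Phi> (of_real (ln t) + \<i> * of_real 0)))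
        has_real_derivative sin (pi * (N - real n)) * slit_density N \<gamma> lam n t) (at t)"
      using DERIV_diff [OF edge [OF t, of pi] edge [OF t, of 0]] Im_H_real [OF t] Im_H_edge [OF t] t by simp
    moreover have "eventually (\<lambda>s. Im (\<Phi> (of_real (ln s) + \<i> * of_real pi)) - Im (\<Phi> (of_real (ln s) + \<i> * of_real 0))
         = K s) (nhds t)"
      using eventually_nhds_in_open [of "{0<..<1/lam}" t] t
      by (auto elim!: eventually_mono simp: K_def J)
    ultimately show ?thesis
      by (rule DERIV_cong_ev [OF refl _ refl, THEN iffD1, rotated])
  qed
  obtain C where C: "\<And>w. Re w \<le> ln (lam / 2) \<Longrightarrow>
    norm (log_kernel N \<gamma> lam n w - principal_part c lam n w) \<le> C * (exp ((N + 1) * Re w) + exp (Re w))"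
    using regular_part_bound_at_0 [OF lam] by blast
  have K_bound: "\<bar>K t\<bar> \<le> C * (t powr (N + 1) + t) * pi" if t: "0 < t" "t \<le> lam / 2" for t
  proof -
    have "1 < 1 / lam" using lam by simp
    then have "t < 1 / lam" using t lam by linarith
    have ln_le: "ln t \<le> ln (lam / 2)" using t lam by simp
    have ne: "of_real (ln t) + \<i> * of_real \<phi> \<noteq> complex_of_real (ln lam)" for \<phi>
      using t lam by (auto simp: complex_eq_iff)
    have H_bound: "norm (H (of_real (ln t) + \<i> * of_real \<phi>)) \<le> C * (t powr (N + 1) + t)" for \<phi>
      using C [of "of_real (ln t) + \<i> * of_real \<phi>"] ln_le t
      by (simp add: H [OF ne] powr_def)
    then have "0 \<le> C * (t powr (N + 1) + t)"
      using norm_ge_zero order_trans by blast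
    with H_bound have "norm (J t) \<le> C * (t powr (N + 1) + t) * measure lborel {0..pi}"
      unfolding J_def
      using has_integral_bound_real [OF _ finite.emptyI integrable_integral [OF int [OF t(1) \<open>t < 1 / lam\<close>]]] by blast
    then have "norm (J t) \<le> C * (t powr (N + 1) + t) * pi" by simp
    moreover have "\<bar>K t\<bar> \<le> norm (J t)"
      using t abs_Re_le_cmod by (simp add: K_def)
    ultimately show ?thesis by linarith
  qed
  have K_0: "(K \<longlongrightarrow> K 0) (at_right 0)"
  proof -
    have "((\<lambda>t. C * (t powr (N + 1) + t) * pi) \<longlongrightarrow> C * (0 powr (N + 1) + 0) * pi) (at_right 0)"
      using N by (intro tendsto_intros tendsto_powr2) (auto simp: eventually_at_filter)
    then have "((\<lambda>t. C * (t powr (N + 1) + t) * pi) \<longlongrightarrow> 0) (at_right 0)"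
      by simp
    moreover have "eventually (\<lambda>t. norm (K t) \<le> C * (t powr (N + 1) + t) * pi) (at_right 0)"
      using eventually_at_right_real [of 0 "lam / 2"] lam K_bound
      by (auto elim!: eventually_mono)
    ultimately have "(K \<longlongrightarrow> 0) (at_right 0)"
      by (rule Lim_null_comparison [rotated])
    then show ?thesis by (simp add: K_def)
  qed
  have "continuous_on {0..x} K"
    unfolding continuous_on_def
  proof
    fix t assume t: "t \<in> {0..x}"
    show "(K \<longlongrightarrow> K t) (at t within {0..x})"
    proof (cases "t = 0")
      case True
      then show ?thesis using K_0 x by (simp add: at_within_Icc_at_right)
    next
      case False
      then have "(K \<longlongrightarrow> K t) (at t)"
        using t x DERIV_isCont [OF K' [of t]] by (auto simp: isCont_def)
      then show ?thesis
        by (rule tendsto_within_subset) auto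
    qed
  qed
  then have "((\<lambda>t. sin (pi * (N - real n)) * slit_density N \<gamma> lam n t) has_integral (K x - K 0)) {0..x}"
    using x K' by (intro fundamental_theorem_of_calculus_interior)
      (auto simp flip: has_real_derivative_iff_has_vector_derivative)
  then show "((\<lambda>t. sin (pi * (N - real n)) * slit_density N \<gamma> lam n t) has_integral Re (J x)) {0..x}"
    using x by (simp add: K_def)
qed

section \<open>The integral formula\<close>

text \<open>When the sine factor is zero, the fundamental theorem of calculus says nothing about the density,
  so integrability comes from the factorisation into \<open>t powr N\<close> and a continuous function.\<close>
lemma slit_density_absolutely_integrable:
  assumes "N > -1" "0 < lam" "0 \<le> x"
  shows "slit_density N \<gamma> lam n absolutely_integrable_on {0..x}"
proof -
  have powr_int: "(\<lambda>t. t powr N) absolutely_integrable_on {0..x}"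
    using has_integral_powr_from_0 [OF assms(1,3)]
    by (intro nonnegative_absolutely_integrable_1 has_integral_integrable) auto
  have cont: "continuous_on {0..x} (\<lambda>t. (1 + lam * t) powr \<gamma> / (t + lam) ^ Suc n)"
  proof (intro continuous_intros ballI)
    fix t assume t: "t \<in> {0..x}"
    then have "0 < t + lam" "0 < 1 + lam * t"
      using assms by (auto intro: add_pos_nonneg add_nonneg_pos)
    then show "(t + lam) ^ Suc n \<noteq> 0" "1 + lam * t \<noteq> 0"
      by simp_all
  qed
  then have "(\<lambda>t. (1 + lam * t) powr \<gamma> / (t + lam) ^ Suc n) \<in> borel_measurable (lebesgue_on {0..x})"
    by (intro continuous_imp_measurable_on_sets_lebesgue) auto
  moreover have "bounded ((\<lambda>t. (1 + lam * t) powr \<gamma> / (t + lam) ^ Suc n) ` {0..x})"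
    by (intro compact_imp_bounded compact_continuous_image cont) simp
  ultimately have "(\<lambda>t. (1 + lam * t) powr \<gamma> / (t + lam) ^ Suc n * t powr N) absolutely_integrable_on {0..x}"
    by (intro absolutely_integrable_bounded_measurable_product_real powr_int) auto
  then show ?thesis
    by (simp add: slit_density_def [abs_def] mult.commute)
qed

text \<open>For \<open>\<phi>\<close> up to and including \<open>pi\<close>, the principal logarithm of \<open>x * exp (\<i> * \<phi>)\<close> is \<open>ln x + \<i> * \<phi>\<close>.\<close>
lemma log_kernel_eq_integrand:
  fixes a \<alpha> \<beta> lam x \<phi> :: real
  assumes "0 < lam" "0 < x" "x < 1 / lam" "0 \<le> \<phi>" "\<phi> \<le> pi"
  defines "z \<equiv> of_real x * exp (\<i> * complex_of_real \<phi>)"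
  shows "z powr complex_of_real (\<alpha> + 1)
               * ((1 - complex_of_real lam * z) powr complex_of_real \<beta> / (z - complex_of_real lam))
               * (z powr complex_of_real (a + 1)
                   * ((1 - complex_of_real lam * z) / (z - complex_of_real lam))) ^ n
         = log_kernel ((a + 1) * real n + \<alpha>) (\<beta> + real n) lam n (of_real (ln x) + \<i> * of_real \<phi>)"
proof -
  let ?w = "of_real (ln x) + \<i> * of_real \<phi>"
  have z: "exp ?w = z"
    using assms by (simp add: z_def exp_add exp_of_real)
  have "z \<noteq> 0" by (simp flip: z)
  have "Ln z = ?w"
    using assms pi_gt_zero by (intro Ln_unique z) (auto simp del: pi_gt_zero)
  then have powr_z: "z powr e = exp (e * ?w)" for e
    using \<open>z \<noteq> 0\<close> by (simp add: powr_def)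
  have "norm (of_real lam * z) < 1"
    using assms by (simp add: z_def norm_mult field_simps)
  then have ne: "1 - of_real lam * z \<noteq> 0"
    by auto
  have "z powr of_real (\<alpha> + 1) * (z powr of_real (a + 1)) ^ n = exp (of_real ((a + 1) * real n + \<alpha> + 1) * ?w)"
    unfolding powr_z by (simp add: algebra_simps flip: exp_of_nat_mult exp_add)
  moreover have "(1 - of_real lam * z) powr of_real \<beta> * (1 - of_real lam * z) ^ n
      = (1 - of_real lam * z) powr of_real (\<beta> + real n)"
    using ne by (simp add: powr_add powr_nat')
  moreover have "p * (q / d) * (p' * (y / d)) ^ n = (p * p' ^ n) * (q * y ^ n) / d ^ Suc n"
    for p q d p' y :: complex
    by (simp add: power_mult_distrib power_divide)
  ultimately show ?thesis
    unfolding log_kernel_def z by simp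
qed

lemma slit_density_eq_integrand:
  fixes a \<alpha> \<beta> lam t :: real
  assumes "0 < lam" "0 \<le> t"
  shows "((1 + lam * t) powr \<beta> * t powr \<alpha> / (t + lam)) * (t powr (a + 1) * ((1 + lam * t) / (t + lam))) ^ n
           = slit_density ((a + 1) * real n + \<alpha>) (\<beta> + real n) lam n t"
proof -
  have pos: "1 + lam * t > 0"
    using assms by (simp add: add_pos_nonneg)
  have "t powr \<alpha> * (t powr (a + 1)) ^ n = t powr ((a + 1) * real n + \<alpha>)"
  proof (cases "t = 0 \<or> n = 0")
    case False
    then have "(t powr (a + 1)) ^ n = t powr ((a + 1) * real n)"
      using assms by (simp add: powr_powr flip: powr_realpow)
    then show ?thesis by (simp add: powr_add)
  qed auto
  moreover have "(1 + lam * t) powr \<beta> * (1 + lam * t) ^ n = (1 + lam * t) powr (\<beta> + real n)"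
    using pos by (simp add: powr_add powr_realpow)
  moreover have "q * p / d * (p' * (y / d)) ^ n = (p * p' ^ n) * (q * y ^ n) / d ^ Suc n"
    for p q d p' y :: real
    by (simp add: power_mult_distrib power_divide)
  ultimately show ?thesis
    unfolding slit_density_def by simp
qed

text \<open>The principal part contributes only through its simple pole, which yields the Taylor coefficient
  of order \<open>n\<close>; the regular part contributes the slit integral.\<close>
lemma half_circle_integral_log_kernel:
  fixes N \<gamma> lam x :: real and n :: nat
  assumes lam: "0 < lam" "lam < 1" and N: "N > -1" and x: "lam < x" "x < 1 / lam"
  defines "f \<equiv> \<lambda>\<phi>. log_kernel N \<gamma> lam n (of_real (ln x) + \<i> * of_real \<phi>)"
  shows "f absolutely_integrable_on {0..pi}"
    and "Re (integral {0..pi} f) = pi * taylor_coeff N \<gamma> lam n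
           + sin (pi * (N - real n)) * integral {0..x} (slit_density N \<gamma> lam n)"
proof -
  let ?w = "\<lambda>\<phi>. of_real (ln x) + \<i> * complex_of_real \<phi>"
  let ?c = "taylor_coeff N \<gamma> lam"
  have "0 < x" using lam x by simp
  have "ln x < ln (1 / lam)" using x \<open>0 < x\<close> lam by (subst ln_less_cancel_iff) auto
  then have "ln x < - ln lam" using lam by (simp add: ln_div)
  moreover have ne: "?w \<phi> \<noteq> of_real (ln lam)" for \<phi>
    using x lam by (auto simp: complex_eq_iff)
  ultimately have "?w ` {0..pi} \<subseteq> half_strip lam - {of_real (ln lam)}"
    using pi_gt_zero by (auto simp: half_strip_def simp del: pi_gt_zero)
  then have "continuous_on {0..pi} f"
    unfolding f_def
    by (intro continuous_on_compose2 [OF holomorphic_on_imp_continuous_on [OF log_kernel_holomorphic [OF lam(1)]]]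
        continuous_intros)
  then show "f absolutely_integrable_on {0..pi}"
    by (rule absolutely_integrable_continuous_real)
  obtain H where hol: "H holomorphic_on half_strip lam"
    and H: "\<And>w. w \<noteq> of_real (ln lam) \<Longrightarrow> H w = log_kernel N \<gamma> lam n w - principal_part ?c lam n w"
    and H_pole: "Im (H (of_real (ln lam))) = 0"
    using regular_part_exists [OF lam] by blast
  note regular = regular_part_integral [OF lam N \<open>0 < x\<close> x(2) hol H H_pole]
  define u where "u k \<phi> = exp (?w \<phi>) * (exp (?w \<phi>) - of_real lam) ^ k / (exp (?w \<phi>) - of_real lam) ^ Suc n" for k \<phi>
  have u: "u k integrable_on {0..pi}" "Re (integral {0..pi} (u k)) = (if k = n then pi else 0)" if "k \<le> n" for k
    using half_circle_integral_principal_term [OF lam(1) x(1) that] unfolding u_def by simp_all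
  have split: "f = (\<lambda>\<phi>. H (?w \<phi>) + (\<Sum>k\<le>n. of_real (?c k) * u k \<phi>))"
    unfolding f_def using H [OF ne] by (simp add: principal_part_def u_def)
  have "integral {0..pi} f = integral {0..pi} (\<lambda>\<phi>. H (?w \<phi>))
           + (\<Sum>k\<le>n. of_real (?c k) * integral {0..pi} (u k))"
  proof -
    have term_int: "(\<lambda>\<phi>. of_real (?c k) * u k \<phi>) integrable_on {0..pi}" if "k \<in> {..n}" for k
      using u(1) that by (intro integrable_on_mult_right) simp
    have "integral {0..pi} (\<lambda>\<phi>. \<Sum>k\<le>n. of_real (?c k) * u k \<phi>) = (\<Sum>k\<le>n. of_real (?c k) * integral {0..pi} (u k))"
      by (subst integral_sum) (use term_int in simp_all)
    then show ?thesis
      unfolding split using regular(1) term_int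
      by (subst integral_add) (auto intro!: integrable_sum)
  qed
  then have "Re (integral {0..pi} f) = Re (integral {0..pi} (\<lambda>\<phi>. H (?w \<phi>)))
           + (\<Sum>k\<le>n. ?c k * Re (integral {0..pi} (u k)))"
    by simp
  also have "(\<Sum>k\<le>n. ?c k * Re (integral {0..pi} (u k))) = (\<Sum>k\<le>n. if k = n then ?c k * pi else 0)"
    by (intro sum.cong refl) (simp add: u(2))
  also have "\<dots> = pi * ?c n" by simp
  also have "Re (integral {0..pi} (\<lambda>\<phi>. H (?w \<phi>)))
      = sin (pi * (N - real n)) * integral {0..x} (slit_density N \<gamma> lam n)"
    using integral_unique [OF regular(2)] by simp
  finally show "Re (integral {0..pi} f) = pi * ?c n
           + sin (pi * (N - real n)) * integral {0..x} (slit_density N \<gamma> lam n)"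
    by simp
qed

theorem lemma2:
  fixes n :: nat and a \<alpha> \<beta> lam x :: real
  assumes "a > -1"
    and "(a + 1) * real n + \<alpha> > -1"
    and "lam \<in> {0<..<1}"
    and "x \<in> {lam<..<1 / lam}"
  shows
    "let F = (\<lambda>z::complex. z powr complex_of_real (\<alpha> + 1)
               * ((1 - complex_of_real lam * z) powr complex_of_real \<beta> / (z - complex_of_real lam))
               * (z powr complex_of_real (a + 1)
                   * ((1 - complex_of_real lam * z) / (z - complex_of_real lam))) ^ n);
         f = (\<lambda>\<phi>::real. F (complex_of_real x * exp (\<i> * complex_of_real \<phi>)));
         g = (\<lambda>t::real. ((1 + lam * t) powr \<beta> * t powr \<alpha> / (t + lam))
               * (t powr (a + 1) * ((1 + lam * t) / (t + lam))) ^ n)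
     in f absolutely_integrable_on {0..pi} \<and>
        g absolutely_integrable_on {0..x} \<and>
        lam powr (a * real n + \<alpha>) * (1 - lam\<^sup>2) powr \<beta>
            * jacobi_P n (a * real n + \<alpha>) \<beta> (1 - 2 * lam\<^sup>2)
          = 1 / pi * Re (integral {0..pi} f)
            - sin (pi * (a * real n + \<alpha>)) / pi * integral {0..x} g"
proof -
  define A where "A = a * real n + \<alpha>"
  define N where "N = (a + 1) * real n + \<alpha>"
  define \<gamma> where "\<gamma> = \<beta> + real n"
  have lam: "0 < lam" "lam < 1" and x: "lam < x" "x < 1 / lam" and N: "N > -1"
    using assms by (auto simp: N_def)
  have "0 < x" using lam x by simp
  define f where "f = (\<lambda>\<phi>. let z = complex_of_real x * exp (\<i> * complex_of_real \<phi>) in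
      z powr complex_of_real (\<alpha> + 1)
        * ((1 - complex_of_real lam * z) powr complex_of_real \<beta> / (z - complex_of_real lam))
        * (z powr complex_of_real (a + 1) * ((1 - complex_of_real lam * z) / (z - complex_of_real lam))) ^ n)"
  define g where "g = (\<lambda>t::real. ((1 + lam * t) powr \<beta> * t powr \<alpha> / (t + lam))
               * (t powr (a + 1) * ((1 + lam * t) / (t + lam))) ^ n)"
  have f: "f \<phi> = log_kernel N \<gamma> lam n (of_real (ln x) + \<i> * of_real \<phi>)" if "\<phi> \<in> {0..pi}" for \<phi>
    unfolding f_def Let_def N_def \<gamma>_def
    using that \<open>0 < x\<close> x lam by (intro log_kernel_eq_integrand) auto
  have g: "g t = slit_density N \<gamma> lam n t" if "t \<in> {0..x}" for t
    unfolding g_def N_def \<gamma>_def using that lam by (intro slit_density_eq_integrand) auto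
  note kernel = half_circle_integral_log_kernel [OF lam N x, of \<gamma> n]
  have "f absolutely_integrable_on {0..pi} \<longleftrightarrow>
      (\<lambda>\<phi>. log_kernel N \<gamma> lam n (of_real (ln x) + \<i> * of_real \<phi>)) absolutely_integrable_on {0..pi}"
    by (rule set_integrable_cong [OF refl refl]) (rule f)
  with kernel(1) have "f absolutely_integrable_on {0..pi}"
    by (rule iffD2 [rotated])
  moreover have "g absolutely_integrable_on {0..x} \<longleftrightarrow>
      slit_density N \<gamma> lam n absolutely_integrable_on {0..x}"
    by (rule set_integrable_cong [OF refl refl]) (rule g)
  then have "g absolutely_integrable_on {0..x}"
    by (rule iffD2) (use slit_density_absolutely_integrable N lam(1) \<open>0 < x\<close> in simp)
  moreover have "lam powr A * (1 - lam\<^sup>2) powr \<beta> * jacobi_P n A \<beta> (1 - 2 * lam\<^sup>2)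
      = 1 / pi * Re (integral {0..pi} f) - sin (pi * A) / pi * integral {0..x} g"
  proof -
    have "N = real n + A" "\<gamma> = real n + \<beta>"
      by (simp_all add: N_def A_def \<gamma>_def algebra_simps)
    then have coeff: "taylor_coeff N \<gamma> lam n
        = lam powr A * (1 - lam\<^sup>2) powr \<beta> * jacobi_P n A \<beta> (1 - 2 * lam\<^sup>2)" and "N - real n = A"
      using taylor_coeff_eq_jacobi_P [OF lam, of n A \<beta>] by simp_all
    have "integral {0..pi} f = integral {0..pi} (\<lambda>\<phi>. log_kernel N \<gamma> lam n (of_real (ln x) + \<i> * of_real \<phi>))"
      by (rule integral_cong) (rule f)
    moreover have "integral {0..x} g = integral {0..x} (slit_density N \<gamma> lam n)"
      by (rule integral_cong) (rule g)
    ultimately have "Re (integral {0..pi} f) = pi * taylor_coeff N \<gamma> lam n + sin (pi * A) * integral {0..x} g"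
      using kernel(2) \<open>N - real n = A\<close> by simp
    then show ?thesis
      unfolding coeff by (simp add: field_simps)
  qed
  ultimately show ?thesis
    unfolding f_def g_def A_def Let_def by blast
qed

end
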